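(* Let $Z$ be an $n$-dimensional supersolvable Zinbiel algebra over a field $F$, and let $A$ be an abelian subalgebra of maximal dimension of $Z$ which has codimension two in $Z$, so that $\alpha(Z)=n-2$. Then $\beta(Z)=n-2$ or $\beta(Z)=n-3$.
   Context: A Zinbiel algebra over a field $F$ is an $F$-vector space $Z$ with a bilinear product $[\cdot,\cdot]$ satisfying the Zinbiel identity $[[x,y],z]=[x,[y,z]]+[x,[z,y]]$ for all $x,y,z\in Z$. A subalgebra or ideal $A$ is abelian if $[a,b]=0$ for all $a,b\in A$. An ideal is two-sided: a subspace $I$ with $[Z,I]\subseteq I$ and $[I,Z]\subseteq I$. An $n$-dimensional Zinbiel algebra $Z$ is supersolvable if there is a chain $0=Z_0\subset Z_1\subset\cdots\subset Z_{n-1}\subset Z_n=Z$ where each $Z_i$ is an $i$-dimensional ideal of $Z$. The invariants are $\alpha(Z)=\max\{\dim A : A \text{ is an abelian subalgebra of } Z\}$ and $\beta(Z)=\max\{\dim B : B \text{ is an abelian ideal of } Z\}$. *)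

theory Defs
  imports Complex_Main
begin

text \<open>
  The Zinbiel algebra is the whole type \<open>'z\<close>, a vector space over an arbitrary field \<open>'f\<close> via
  \<open>scale\<close>; the bracket \<open>[x, y]\<close> is written \<open>x \<star> y\<close>. Subalgebras and ideals are subsets of \<open>'z\<close>.
\<close>

locale zinbiel_algebra = vector_space scale
  for scale :: "'f::field \<Rightarrow> 'z::ab_group_add \<Rightarrow> 'z" (infixr "*s" 75) +
  fixes zprod :: "'z \<Rightarrow> 'z \<Rightarrow> 'z" (infixl "\<star>" 70)
  assumes linear_right: "Vector_Spaces.linear scale scale (\<lambda>y. x \<star> y)"
    and linear_left: "Vector_Spaces.linear scale scale (\<lambda>x. x \<star> y)"
    and zinbiel: "(x \<star> y) \<star> z = x \<star> (y \<star> z) + x \<star> (z \<star> y)"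
begin

text \<open>Stated separately because \<open>dim\<close> takes the value 0 on infinite-dimensional spaces.\<close>

definition finite_dimensional :: bool
  where "finite_dimensional \<longleftrightarrow> (\<exists>B. finite B \<and> span B = UNIV)"

definition subalgebra :: "'z set \<Rightarrow> bool"
  where "subalgebra A \<longleftrightarrow> subspace A \<and> (\<forall>a\<in>A. \<forall>b\<in>A. a \<star> b \<in> A)"

definition ideal :: "'z set \<Rightarrow> bool"
  where "ideal I \<longleftrightarrow> subspace I \<and> (\<forall>z. \<forall>a\<in>I. z \<star> a \<in> I \<and> a \<star> z \<in> I)"

definition abelian :: "'z set \<Rightarrow> bool"
  where "abelian A \<longleftrightarrow> (\<forall>a\<in>A. \<forall>b\<in>A. a \<star> b = 0)"

definition supersolvable :: bool
  where "supersolvable \<longleftrightarrow> finite_dimensional \<and>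
    (\<exists>C :: nat \<Rightarrow> 'z set. C 0 = {0} \<and> C (dim UNIV) = UNIV \<and>
      (\<forall>i < dim UNIV. C i \<subset> C (Suc i)) \<and>
      (\<forall>i \<le> dim UNIV. ideal (C i) \<and> dim (C i) = i))"

text \<open>
  In finite dimension the sets below are finite and contain \<open>dim {0}\<close>, so \<open>Max\<close> is a genuine maximum.
\<close>

definition alpha :: nat
  where "alpha = Max {dim A | A. subalgebra A \<and> abelian A}"

definition beta :: nat
  where "beta = Max {dim B | B. ideal B \<and> abelian B}"

end

end

theory Submission
  imports Defs
begin

text \<open>
  An ideal chain with one-dimensional factors forces nilpotency: \<open>Z\<close> acts on each factor by scalars,
  and the Zinbiel identity makes these scalars vanish. Hence every proper subspace \<open>S\<close> admits
  \<open>x \<notin> S\<close> whose products with \<open>Z\<close> all lie in \<open>S\<close>. Applied to \<open>A\<close>, and then to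
  \<open>B = A + Fx\<close>, this gives \<open>Z = A + Fx + Fy\<close> with \<open>xZ, Zx \<subseteq> A\<close> and \<open>yZ, Zy \<subseteq> B\<close>.
  If \<open>A\<close> is not an ideal, then \<open>xA = 0\<close>. If moreover some \<open>ay + ya\<close> were outside \<open>A\<close>, then
  \<open>Ax = 0\<close>, and either \<open>B\<close> would be abelian or \<open>A\<close> an ideal; so \<open>ay + ya \<in> A\<close> throughout, and
  \<open>{a \<in> A. ay \<in> A}\<close> is an abelian ideal of codimension one in \<open>A\<close>.
\<close>

text \<open>The dimension lemmas of \<open>finite_dimensional_vector_space\<close> need a named
  finite basis; the final proof extracts one from a finite spanning set.\<close>

locale finite_dimensional_zinbiel_algebra =
  zinbiel_algebra scale zprod + finite_dimensional_vector_space scale Basis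
  for scale :: "'f::field \<Rightarrow> 'z::ab_group_add \<Rightarrow> 'z" (infixr "*s" 75)
    and zprod :: "'z \<Rightarrow> 'z \<Rightarrow> 'z" (infixl "\<star>" 70)
    and Basis :: "'z set"

section \<open>Bilinearity and extension of a subspace by one vector\<close>

context zinbiel_algebra
begin

lemma
  shows prod_add_right: "x \<star> (y + z) = x \<star> y + x \<star> z"
    and prod_scale_right: "x \<star> (c *s y) = c *s (x \<star> y)"
    and prod_add_left: "(y + z) \<star> x = y \<star> x + z \<star> x"
    and prod_scale_left: "(c *s y) \<star> x = c *s (y \<star> x)"
  using linear_right[of x] linear_left[of x]
  unfolding Vector_Spaces.linear_iff_module_hom module_hom_iff by blast+

lemma
  shows prod_zero_right [simp]: "x \<star> 0 = 0"
    and prod_zero_left [simp]: "0 \<star> x = 0"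
  using prod_scale_right[of x 0 0] prod_scale_left[of 0 0 x] by simp_all

lemmas prod_linear = prod_add_right prod_scale_right prod_add_left prod_scale_left

lemma ideal_imp_subalgebra: "ideal I \<Longrightarrow> subalgebra I"
  unfolding ideal_def subalgebra_def by blast

lemma mem_span_insert_subspace:
  assumes "subspace S" "b \<in> span (insert x S)"
  obtains s a where "b = s *s x + a" "a \<in> S"
proof -
  obtain s where "b - s *s x \<in> span S"
    using assms(2) span_breakdown_eq by blast
  moreover have "span S = S" using assms(1) span_eq_iff by blast
  ultimately show ?thesis using that[of s "b - s *s x"] by simp
qed

text \<open>Allows coefficients of \<open>x\<close> to be compared modulo \<open>S\<close>, turning
  congruences into equations in the field.\<close>

lemma subspace_scale_add_mem_iff:
  assumes "subspace S" "a \<in> S" "x \<notin> S"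
  shows "s *s x + a \<in> S \<longleftrightarrow> s = 0"
proof
  assume "s *s x + a \<in> S"
  then have "s *s x \<in> S"
    using subspace_diff[OF assms(1) _ assms(2)] by fastforce
  then have "s \<noteq> 0 \<Longrightarrow> inverse s *s (s *s x) \<in> S"
    using subspace_scale assms(1) by blast
  then show "s = 0" using assms(3) by (cases "s = 0") auto
qed (use assms in simp)

end

section \<open>Dimensions and the invariants \<open>alpha\<close> and \<open>beta\<close>\<close>

context finite_dimensional_zinbiel_algebra
begin

lemma dim_le: "dim S \<le> dim (UNIV :: 'z set)"
  by (rule dim_subset) simp

lemma finite_dims: "finite {dim S | S. P S}"
  by (rule finite_subset[of _ "{..dim (UNIV :: 'z set)}"]) (use dim_le in auto)

lemma alpha_ge: "subalgebra A \<Longrightarrow> abelian A \<Longrightarrow> dim A \<le> alpha"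
  unfolding alpha_def by (rule Max_ge[OF finite_dims]) blast

lemma beta_ge: "ideal B \<Longrightarrow> abelian B \<Longrightarrow> dim B \<le> beta"
  unfolding beta_def by (rule Max_ge[OF finite_dims]) blast

lemma beta_le_alpha: "beta \<le> alpha"
proof -
  \<comment> \<open>The zero ideal gives the nonemptiness that \<open>Max_mono\<close>
    requires.\<close>
  have "ideal {0}" "abelian {0}"
    unfolding ideal_def abelian_def by auto
  then have "{dim B | B. ideal B \<and> abelian B} \<noteq> {}" by blast
  then show ?thesis
    unfolding beta_def alpha_def
    by (intro Max_mono finite_dims) (auto dest: ideal_imp_subalgebra)
qed

lemma dim_insert_notin_subspace:
  assumes "subspace S" "x \<notin> S"
  shows "dim (span (insert x S)) = dim S + 1"
  using assms by (metis dim_insert dim_span span_eq_iff)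

lemma span_insert_eq:
  assumes "subspace S" "subspace T" "S \<subseteq> T" "m \<in> T" "m \<notin> S" "dim T = dim S + 1"
  shows "span (insert m S) = T"
proof (rule subspace_dim_equal)
  show "span (insert m S) \<subseteq> T" by (rule span_minimal) (use assms in auto)
  show "dim T \<le> dim (span (insert m S))"
    using assms(6) dim_insert_notin_subspace[OF assms(1,5)] by linarith
qed (use assms in auto)

section \<open>Nilpotent action along a chain of ideals\<close>

context
  fixes C :: "nat \<Rightarrow> 'z set" and n :: nat
  assumes chain_0: "C 0 = {0}" and chain_n: "C n = UNIV"
    and chain_mono: "i < n \<Longrightarrow> C i \<subset> C (Suc i)"
    and chain_ideal: "i \<le> n \<Longrightarrow> ideal (C i)"
    and chain_dim: "i \<le> n \<Longrightarrow> dim (C i) = i"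
begin

lemma chain_subspace: "i \<le> n \<Longrightarrow> subspace (C i)"
  using chain_ideal unfolding ideal_def by blast

text \<open>The factor of \<open>C (Suc i)\<close> by \<open>C i\<close> is one-dimensional, so any
  \<open>m\<close> outside \<open>C i\<close> generates it.\<close>

lemma chain_step:
  assumes "i < n" "m \<in> C (Suc i)" "m \<notin> C i" "u \<in> C (Suc i)"
  obtains s a where "u = s *s m + a" "a \<in> C i"
proof (rule mem_span_insert_subspace)
  show "u \<in> span (insert m (C i))"
    using assms chain_mono[of i] chain_dim
    by (subst span_insert_eq[of _ "C (Suc i)"]) (auto intro: chain_subspace)
qed (use assms chain_subspace in auto)

text \<open>
  For \<open>zm \<equiv> \<lambda>(z)m\<close> and \<open>mz \<equiv> \<mu>(z)m\<close> modulo \<open>C i\<close>, the identity for \<open>(zm)z\<close> reads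
  \<open>\<lambda>(z)\<mu>(z) = \<lambda>(z)\<mu>(z) + \<lambda>(z)\<^sup>2\<close>.
\<close>
lemma chain_prod_left:
  assumes i: "i < n" and m: "m \<in> C (Suc i)"
  shows "z \<star> m \<in> C i"
proof (cases "m \<in> C i")
  case True
  then show ?thesis using chain_ideal[of i] i unfolding ideal_def by simp
next
  case False
  have sub: "subspace (C i)" and idl: "ideal (C i)" and idl': "ideal (C (Suc i))"
    using i chain_subspace chain_ideal by auto
  obtain l a where l: "z \<star> m = l *s m + a" "a \<in> C i"
    using chain_step[OF i m False, of "z \<star> m"] idl' m unfolding ideal_def by blast
  obtain r b where r: "m \<star> z = r *s m + b" "b \<in> C i"
    using chain_step[OF i m False, of "m \<star> z"] idl' m unfolding ideal_def by blast
  have mem: "a \<star> z \<in> C i" "z \<star> a \<in> C i" "z \<star> b \<in> C i"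
    using idl l r unfolding ideal_def by auto
  have "(z \<star> m) \<star> z = z \<star> (m \<star> z) + z \<star> (z \<star> m)" by (rule zinbiel)
  then have "l *s (r *s m + b) + a \<star> z
      = r *s (l *s m + a) + z \<star> b + (l *s (l *s m + a) + z \<star> a)"
    by (simp only: l(1) r(1) prod_linear)
  then have "(l * l) *s m + (r *s a + z \<star> b + l *s a + z \<star> a - l *s b - a \<star> z) = 0"
    by (simp add: algebra_simps scale_right_distrib)
  moreover have "r *s a + z \<star> b + l *s a + z \<star> a - l *s b - a \<star> z \<in> C i"
    using sub mem l r by (intro subspace_add subspace_diff subspace_scale)
  ultimately have "l * l = 0"
    using subspace_scale_add_mem_iff[OF sub _ False] subspace_0[OF sub] by metis
  then show ?thesis using l by simp
qed

text \<open>
  With \<open>\<mu>\<close> as above, \<open>\<mu>(u)\<^sup>2 = 2\<mu>(uu)\<close>, and \<open>uu\<close> lies one step further down the chain than \<open>u\<close>.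
\<close>
lemma chain_prod_right:
  assumes i: "i < n" and m: "m \<in> C (Suc i)" and "j \<le> n" "u \<in> C j"
  shows "m \<star> u \<in> C i"
  using assms(3,4)
proof (induction j arbitrary: u)
  case 0
  then show ?case using chain_0 chain_subspace[of i] i subspace_0 by simp
next
  case (Suc j)
  show ?case
  proof (cases "m \<in> C i")
    case True
    then show ?thesis using chain_ideal[of i] i unfolding ideal_def by simp
  next
    case False
    have sub: "subspace (C i)" and idl: "ideal (C i)" and idl': "ideal (C (Suc i))"
      using i chain_subspace chain_ideal by auto
    obtain r b where r: "m \<star> u = r *s m + b" "b \<in> C i"
      using chain_step[OF i m False, of "m \<star> u"] idl' m unfolding ideal_def by blast
    have "u \<star> u \<in> C j" using chain_prod_left Suc.prems by simp
    then have uu: "m \<star> (u \<star> u) \<in> C i" using Suc.IH Suc.prems by simp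
    have bu: "b \<star> u \<in> C i" using idl r unfolding ideal_def by auto
    have "(m \<star> u) \<star> u = m \<star> (u \<star> u) + m \<star> (u \<star> u)" by (rule zinbiel)
    then have "(r * r) *s m + (r *s b + b \<star> u) = m \<star> (u \<star> u) + m \<star> (u \<star> u)"
      by (simp add: r(1) prod_linear scale_right_distrib algebra_simps)
    moreover have "r *s b + b \<star> u \<in> C i"
      using sub bu r by (intro subspace_add subspace_scale)
    ultimately have "r * r = 0"
      using subspace_scale_add_mem_iff[OF sub _ False] subspace_add[OF sub uu uu] by metis
    then show ?thesis using r by simp
  qed
qed

text \<open>Let \<open>C (Suc i)\<close> be the first member of the chain not inside
  \<open>S\<close>. Any \<open>x\<close> in it but outside \<open>S\<close> works, because its
  products fall into \<open>C i\<close>, which lies in \<open>S\<close>.\<close>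

lemma chain_prods_into_proper_subspace:
  assumes "subspace S" "S \<noteq> UNIV"
  shows "\<exists>x. x \<notin> S \<and> (\<forall>z. x \<star> z \<in> S \<and> z \<star> x \<in> S)"
proof -
  define k where "k = (LEAST i. \<not> C i \<subseteq> S)"
  have Cn: "\<not> C n \<subseteq> S" using assms(2) chain_n by auto
  then have k: "\<not> C k \<subseteq> S" "k \<le> n"
    unfolding k_def by (rule LeastI, rule Least_le)
  have "k \<noteq> 0" using k(1) chain_0 subspace_0[OF assms(1)] by (cases k) auto
  then obtain i where i: "k = Suc i" by (cases k) auto
  then have Ci: "C i \<subseteq> S" using not_less_Least[of i "\<lambda>i. \<not> C i \<subseteq> S"] unfolding k_def by auto
  obtain x where x: "x \<in> C (Suc i)" "x \<notin> S" using k i by auto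
  have "x \<star> z \<in> S \<and> z \<star> x \<in> S" for z
    using chain_prod_left[of i x z] chain_prod_right[of i x n z] x k i Ci chain_n by auto
  then show ?thesis using x by blast
qed

end

lemma supersolvable_prods_into_proper_subspace:
  assumes "supersolvable" "subspace S" "S \<noteq> UNIV"
  obtains x where "x \<notin> S" "\<And>z. x \<star> z \<in> S" "\<And>z. z \<star> x \<in> S"
proof -
  obtain C where C: "C 0 = {0}" "C (dim (UNIV :: 'z set)) = UNIV"
    "\<forall>i < dim (UNIV :: 'z set). C i \<subset> C (Suc i)"
    "\<forall>i \<le> dim (UNIV :: 'z set). ideal (C i) \<and> dim (C i) = i"
    using assms(1) unfolding supersolvable_def by blast
  have "\<exists>x. x \<notin> S \<and> (\<forall>z. x \<star> z \<in> S \<and> z \<star> x \<in> S)"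
    by (intro chain_prods_into_proper_subspace[OF C(1,2) C(3)[rule_format]
          C(4)[rule_format, THEN conjunct1] C(4)[rule_format, THEN conjunct2]] assms)
  then show thesis using that by blast
qed

section \<open>Construction of the abelian ideal\<close>

lemma abelian_ideal_of_codim_le_1:
  assumes A: "subspace A" "abelian A" and max: "dim A = alpha"
    and x: "x \<notin> A" "\<And>z. x \<star> z \<in> A" "\<And>z. z \<star> x \<in> A"
    and y: "\<And>z. y \<star> z \<in> span (insert x A)" "\<And>z. z \<star> y \<in> span (insert x A)"
    and Z: "span (insert y (span (insert x A))) = UNIV"
  shows "\<exists>K. ideal K \<and> abelian K \<and> dim A \<le> dim K + 1"
proof (cases "ideal A")
  case True
  then show ?thesis using A by auto
next
  case False
  have AA: "a \<star> b = 0" if "a \<in> A" "b \<in> A" for a b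
    using A that unfolding abelian_def by blast
  have ex: "\<exists>s a. z \<star> y = s *s x + a \<and> a \<in> A" "\<exists>s a. y \<star> z = s *s x + a \<and> a \<in> A" for z
    using mem_span_insert_subspace[OF A(1)] y by metis+
  have decomp: "\<exists>t s a. z = t *s y + (s *s x + a) \<and> a \<in> A" for z
    using mem_span_insert_subspace[OF subspace_span, of z y "insert x A"] Z
      mem_span_insert_subspace[OF A(1)] by (metis UNIV_I)
  \<comment> \<open>As Z = A + Fx + Fy, with \<open>A\<close> abelian and \<open>x\<close>
    multiplying into \<open>A\<close>, only products with \<open>y\<close> can keep \<open>A\<close>
    from being an ideal.\<close>
  have AI: "ideal A" if y_prods: "\<And>a. a \<in> A \<Longrightarrow> a \<star> y \<in> A \<and> y \<star> a \<in> A"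
  proof -
    have "z \<star> a \<in> A \<and> a \<star> z \<in> A" if a: "a \<in> A" for z a
    proof -
      obtain t s b where z: "z = t *s y + (s *s x + b)" "b \<in> A" using decomp by blast
      show ?thesis unfolding z(1) prod_linear
        using a z(2) AA x y_prods
        by (intro conjI subspace_add[OF A(1)] subspace_scale[OF A(1)]) (auto simp: subspace_0[OF A(1)])
    qed
    then show ?thesis using A(1) unfolding ideal_def by blast
  qed
  then obtain a\<^sub>0 where a0: "a\<^sub>0 \<in> A" "a\<^sub>0 \<star> y \<notin> A \<or> y \<star> a\<^sub>0 \<notin> A"
    using False by blast
  have xA: "x \<star> a = 0" if a: "a \<in> A" for a
    using a0(2)
  proof
    assume na: "a\<^sub>0 \<star> y \<notin> A"
    obtain s b where s: "a\<^sub>0 \<star> y = s *s x + b" "b \<in> A" using ex by blast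
    \<comment> \<open>The right side of the Zinbiel identity is symmetric in the last two factors,
      so (uv)w = (uw)v.\<close>
    have "(a\<^sub>0 \<star> y) \<star> a = (a\<^sub>0 \<star> a) \<star> y" by (simp add: zinbiel add.commute)
    then have "s *s (x \<star> a) = 0" using s a a0 AA by (simp add: prod_linear)
    then show ?thesis using na s by auto
  next
    assume na: "y \<star> a\<^sub>0 \<notin> A"
    obtain s b where s: "y \<star> a\<^sub>0 = s *s x + b" "b \<in> A" using ex by blast
    have "(y \<star> a\<^sub>0) \<star> a = 0" using a a0 AA by (simp add: zinbiel)
    then have "s *s (x \<star> a) = 0" using s a AA by (simp add: prod_linear)
    then show ?thesis using na s by auto
  qed
  have sym: "a \<star> y + y \<star> a \<in> A" if a: "a \<in> A" for a
  proof (rule ccontr)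
    assume na: "a \<star> y + y \<star> a \<notin> A"
    have "a \<star> y + y \<star> a \<in> span (insert x A)" using y by (simp add: span_add)
    then obtain s b where s: "a \<star> y + y \<star> a = s *s x + b" "b \<in> A"
      by (rule mem_span_insert_subspace[OF A(1)])
    have Ax: "c \<star> x = 0" if c: "c \<in> A" for c
    proof -
      \<comment> \<open>The Zinbiel identity read backwards: c(ay + ya) = (ca)y, which vanishes
        since ca = 0.\<close>
      have "c \<star> (s *s x + b) = (c \<star> a) \<star> y" by (simp add: zinbiel flip: s(1) prod_add_right)
      then have "s *s (c \<star> x) = 0" using s a c AA by (simp add: prod_linear)
      then show ?thesis using na s by auto
    qed
    \<comment> \<open>Otherwise A + Fx would be an abelian subalgebra of dimension
      \<open>alpha + 1\<close>.\<close>
    have xx: "x \<star> x \<noteq> 0"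
    proof
      assume xx: "x \<star> x = 0"
      have prod0: "u \<star> v = 0" if u: "u \<in> span (insert x A)" and v: "v \<in> span (insert x A)" for u v
      proof -
        obtain p q where "u = p *s x + q" "q \<in> A"
          by (rule mem_span_insert_subspace[OF A(1) u])
        moreover obtain p' q' where "v = p' *s x + q'" "q' \<in> A"
          by (rule mem_span_insert_subspace[OF A(1) v])
        ultimately show ?thesis using xx xA Ax AA by (simp add: prod_linear)
      qed
      have "subalgebra (span (insert x A))" "abelian (span (insert x A))"
        unfolding subalgebra_def abelian_def using prod0 by (auto simp: span_zero)
      then have "dim (span (insert x A)) \<le> alpha" by (rule alpha_ge)
      then show False using dim_insert_notin_subspace[OF A(1) x(1)] max by simp
    qed
    \<comment> \<open>Right multiplication by \<open>x\<close> kills cy and yc, but sends them to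
      their \<open>x\<close>-coefficients times xx; as xx is nonzero, these coefficients
      vanish.\<close>
    have "ideal A"
    proof (rule AI)
      fix c assume c: "c \<in> A"
      obtain p b' where p: "c \<star> y = p *s x + b'" "b' \<in> A" using ex by blast
      obtain q b'' where q: "y \<star> c = q *s x + b''" "b'' \<in> A" using ex by blast
      have "(c \<star> y) \<star> x = 0" using c x AA by (simp add: zinbiel)
      then have "p *s (x \<star> x) = 0" using p Ax by (simp add: prod_linear)
      moreover have "(y \<star> c) \<star> x = 0" using c xA Ax by (simp add: zinbiel)
      then have "q *s (x \<star> x) = 0" using q Ax by (simp add: prod_linear)
      ultimately show "c \<star> y \<in> A \<and> y \<star> c \<in> A" using xx p q by simp
    qed
    then show False using False by simp
  qed
  have sym_iff: "y \<star> a \<in> A \<longleftrightarrow> a \<star> y \<in> A" if "a \<in> A" for a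
    using sym[OF that] subspace_diff[OF A(1)] by (metis add_diff_cancel_left' add_diff_cancel_right')
  \<comment> \<open>\<open>K\<close> is the kernel of the linear functional on \<open>A\<close>
    taking a to the \<open>x\<close>-coefficient of ay modulo \<open>A\<close>. By
    \<open>sym_iff\<close>, using ya gives the same set.\<close>
  define K where "K = {a \<in> A. a \<star> y \<in> A}"
  have K_sub: "subspace K"
    unfolding subspace_def K_def
    using A(1) by (auto simp: prod_linear subspace_0 intro: subspace_add subspace_scale)
  have K_prods: "k \<star> x \<in> K" "k \<star> y \<in> K" "y \<star> k \<in> K" if k: "k \<in> K" for k
  proof -
    have kA: "k \<in> A" "k \<star> y \<in> A" "y \<star> k \<in> A" using k sym_iff unfolding K_def by auto
    have "(k \<star> x) \<star> y = 0" using AA x kA by (simp add: zinbiel)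
    then show "k \<star> x \<in> K" unfolding K_def using x subspace_0[OF A(1)] by simp
    obtain c a where c: "y \<star> y = c *s x + a" "a \<in> A" using ex by blast
    \<comment> \<open>Since yy lies in A + Fx and k kills \<open>A\<close>, k(yy) is a multiple of
      kx; moreover (ky)y = k(yy) + k(yy).\<close>
    have "k \<star> (y \<star> y) \<in> A"
      using c kA AA x by (simp add: prod_linear subspace_scale[OF A(1)])
    then have "(k \<star> y) \<star> y \<in> A" by (simp add: zinbiel subspace_add[OF A(1)])
    then show ky: "k \<star> y \<in> K" unfolding K_def using kA by simp
    \<comment> \<open>Both \<open>x\<close> and \<open>A\<close> annihilate \<open>k\<close> from
      the left, hence so does yy. Expanding (yy)k reduces y(yk) to y(ky), where ky is already in
      \<open>K\<close>.\<close>
    have "(y \<star> y) \<star> k = 0" using c kA AA xA by (simp add: prod_linear)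
    then have "y \<star> (y \<star> k) = - (y \<star> (k \<star> y))" by (simp add: zinbiel eq_neg_iff_add_eq_0)
    moreover have "y \<star> (k \<star> y) \<in> A" using ky sym_iff unfolding K_def by auto
    ultimately have "y \<star> (y \<star> k) \<in> A" using subspace_neg[OF A(1)] by metis
    then show "y \<star> k \<in> K" unfolding K_def using kA sym_iff by simp
  qed
  have "ideal K"
    unfolding ideal_def
  proof (intro conjI K_sub allI ballI)
    fix z k assume k: "k \<in> K"
    obtain t s b where z: "z = t *s y + (s *s x + b)" "b \<in> A" using decomp by blast
    have "k \<in> A" using k unfolding K_def by simp
    then have 0: "b \<star> k = 0" "k \<star> b = 0" "x \<star> k = 0" using z AA xA by auto
    show "z \<star> k \<in> K" "k \<star> z \<in> K"
      unfolding z(1) prod_linear 0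
      using K_prods[OF k] K_sub by (auto intro!: subspace_add subspace_scale simp: subspace_0)
  qed
  moreover have "abelian K" using A(2) unfolding K_def abelian_def by simp
  moreover have "dim A \<le> dim K + 1"
  proof -
    have a0y: "a\<^sub>0 \<star> y \<notin> A" using a0 sym_iff by blast
    obtain p b where p: "a\<^sub>0 \<star> y = p *s x + b" "b \<in> A" using ex by blast
    have p0: "p \<noteq> 0" using a0y p by auto
    have "A \<subseteq> span (insert a\<^sub>0 K)"
    proof
      fix a assume a: "a \<in> A"
      obtain q b' where q: "a \<star> y = q *s x + b'" "b' \<in> A" using ex by blast
      have "(a + t *s a\<^sub>0) \<star> y = (q + t * p) *s x + (b' + t *s b)" for t
        by (simp add: prod_linear p q scale_right_distrib scale_left_distrib)
      \<comment> \<open>This multiple of \<open>a\<^sub>0\<close> cancels the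
        \<open>x\<close>-coefficient of ay, so \<open>a\<close> is congruent to a multiple of
        \<open>a\<^sub>0\<close> modulo \<open>K\<close>.\<close>
      from this[of "- (q / p)"] have "(a + (- (q / p)) *s a\<^sub>0) \<star> y = b' + (- (q / p)) *s b"
        using p0 by simp
      moreover have "b' + (- (q / p)) *s b \<in> A" "a + (- (q / p)) *s a\<^sub>0 \<in> A"
        using A(1) p q a a0 by (auto intro!: subspace_add subspace_scale subspace_diff)
      ultimately have "a - (q / p) *s a\<^sub>0 \<in> K" unfolding K_def by simp
      then show "a \<in> span (insert a\<^sub>0 K)" using span_breakdown_eq span_base by blast
    qed
    moreover have "a\<^sub>0 \<notin> K" using a0y unfolding K_def by simp
    ultimately show ?thesis
      using dim_subset dim_insert_notin_subspace[OF K_sub] by metis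
  qed
  ultimately show ?thesis by blast
qed

section \<open>Comparison of the two invariants\<close>

lemma alpha_le_beta_plus_1:
  assumes "supersolvable" "subalgebra A" "abelian A" "dim A = alpha"
    and "dim A + 2 = dim (UNIV :: 'z set)"
  shows "alpha \<le> beta + 1"
proof -
  have sub: "subspace A" using assms(2) unfolding subalgebra_def by blast
  have "A \<noteq> UNIV" using assms(5) by auto
  then obtain x where x: "x \<notin> A" "\<And>z. x \<star> z \<in> A" "\<And>z. z \<star> x \<in> A"
    using supersolvable_prods_into_proper_subspace[OF assms(1) sub] by metis
  define B where "B = span (insert x A)"
  have dimB: "dim B = dim A + 1"
    unfolding B_def by (rule dim_insert_notin_subspace[OF sub x(1)])
  have subB: "subspace B" unfolding B_def by simp
  have "B \<noteq> UNIV" using assms(5) dimB by auto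
  then obtain y where y: "y \<notin> B" "\<And>z. y \<star> z \<in> B" "\<And>z. z \<star> y \<in> B"
    using supersolvable_prods_into_proper_subspace[OF assms(1) subB] by metis
  have "span (insert y B) = UNIV"
    by (rule span_insert_eq) (use subB y dimB assms(5) in auto)
  then obtain K where "ideal K" "abelian K" "dim A \<le> dim K + 1"
    using abelian_ideal_of_codim_le_1[OF sub assms(3,4) x, of y] y unfolding B_def by blast
  then show ?thesis using beta_ge[of K] assms(4) by simp
qed

end

theorem theorem3p2:
  fixes scale :: "'f::field \<Rightarrow> 'z::ab_group_add \<Rightarrow> 'z"
    and zprod :: "'z \<Rightarrow> 'z \<Rightarrow> 'z"
    and n :: nat
    and A :: "'z set"
  assumes "zinbiel_algebra scale zprod"
    and "zinbiel_algebra.finite_dimensional scale"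
    and "vector_space.dim scale (UNIV :: 'z set) = n"
    and "zinbiel_algebra.supersolvable scale zprod"
    and "zinbiel_algebra.subalgebra scale zprod A"
    and "zinbiel_algebra.abelian zprod A"
    and "vector_space.dim scale A = zinbiel_algebra.alpha scale zprod"
    and "vector_space.dim scale A + 2 = n"
  shows "zinbiel_algebra.beta scale zprod + 2 = n \<or> zinbiel_algebra.beta scale zprod + 3 = n"
proof -
  interpret zinbiel_algebra scale zprod by fact
  obtain S where S: "finite S" "span S = UNIV"
    using assms(2) unfolding finite_dimensional_def by blast
  obtain Basis where "Basis \<subseteq> S" "independent Basis" "S \<subseteq> span Basis"
    using maximal_independent_subset by metis
  then have "finite Basis" "independent Basis" "span Basis = UNIV"
    using S finite_subset span_mono[of S "span Basis"] by (auto simp: span_span)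
  then interpret finite_dimensional_zinbiel_algebra scale zprod Basis
    by unfold_locales
  have "alpha \<le> beta + 1"
    using alpha_le_beta_plus_1 assms(3-8) by simp
  then show ?thesis using beta_le_alpha assms(7,8) by linarith
qed

end
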